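(* Let $A \subset \mathbb{R}^n$ and $B \subset \mathbb{R}^m$ be two bounded, measurable sets. Then the product set $\Omega = A \times B$ can weakly tile its complement in $\mathbb{R}^n \times \mathbb{R}^m$ by translations if and only if both $A$ and $B$ can weakly tile their complements (by translations) in $\mathbb{R}^n$ and $\mathbb{R}^m$, respectively.
   Context: Weak tiling: a bounded, measurable set $\Omega \subset \mathbb{R}^d$ can weakly tile a measurable (possibly unbounded) set $\Sigma \subset \mathbb{R}^d$ by translations if there exists a positive, locally finite Borel measure $\nu$ on $\mathbb{R}^d$ such that $\mathbf{1}_{\Omega} * \nu = \mathbf{1}_{\Sigma}$ almost everywhere with respect to Lebesgue measure. The set $\Omega$ weakly tiles its complement if this holds with $\Sigma = \mathbb{R}^d \setminus \Omega$. *)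

theory Defs
  imports "HOL-Analysis.Analysis"
begin

definition locally_finite_measure :: "'a::topological_space measure \<Rightarrow> bool" where
  "locally_finite_measure \<nu> \<longleftrightarrow>
     (\<forall>x. \<exists>U. open U \<and> x \<in> U \<and> emeasure \<nu> U < \<infinity>)"

(* The convolution (f * \<nu>)(x) is the integral of f(x - y) d\<nu>(y).  The integral is taken over the
   completion of \<nu>, so that f may be Lebesgue (rather than Borel) measurable: if f is Lebesgue
   measurable and \<nu> is a locally finite Borel measure, then for almost every x the function
   f(x - y) of y is measurable for the completion of \<nu>, by Tonelli. *)
definition convolve :: "('a::euclidean_space \<Rightarrow> ennreal) \<Rightarrow> 'a measure \<Rightarrow> 'a \<Rightarrow> ennreal" where
  "convolve f \<nu> x = (\<integral>\<^sup>+ y. f (x - y) \<partial>completion \<nu>)"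

definition weakly_tiles :: "'a::euclidean_space set \<Rightarrow> 'a set \<Rightarrow> bool" where
  "weakly_tiles \<Omega> \<Sigma> \<longleftrightarrow>
     (\<exists>\<nu>. sets \<nu> = sets borel \<and> locally_finite_measure \<nu> \<and>
          (AE x in lebesgue. convolve (indicator \<Omega>) \<nu> x = indicator \<Sigma> x))"

definition weakly_tiles_complement :: "'a::euclidean_space set \<Rightarrow> bool" where
  "weakly_tiles_complement \<Omega> \<longleftrightarrow> weakly_tiles \<Omega> (UNIV - \<Omega>)"

end

theory Submission
  imports Defs "HOL-Probability.Giry_Monad"
begin

text \<open>
  If \<open>M\<close> and \<open>N\<close> tile the complements of \<open>A\<close> and \<open>B\<close>, then \<open>(\<delta>\<^sub>0 + M) \<otimes> (\<delta>\<^sub>0 + N)\<close> tiles the whole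
  space with copies of \<open>A \<times> B\<close>; removing the atom \<open>\<delta>\<^sub>0 \<otimes> \<delta>\<^sub>0\<close> leaves a tiling of the complement.
  Conversely, suppose \<open>\<nu>\<close> tiles the complement of \<open>A \<times> B\<close>. Then neither factor is a null set, and
  for almost every \<open>x \<in> A\<close> the slice over \<open>x\<close> of the complement of \<open>A \<times> B\<close> is the complement of
  \<open>B\<close>, so the restriction of \<open>\<nu>\<close> to \<open>(x - A) \<times> UNIV\<close>, projected to the second factor, tiles it.
  Boundedness of \<open>A\<close> makes this projection locally finite.
\<close>

section \<open>Finiteness on compact and bounded sets, and sigma-finiteness\<close>

lemma locally_finite_measure_compact:
  fixes \<nu> :: "'a::topological_space measure"
  assumes lf: "locally_finite_measure \<nu>" and sets: "sets \<nu> = sets borel" and "compact K"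
  shows "emeasure \<nu> K < \<infinity>"
proof -
  obtain U where U: "\<And>x. open (U x)" "\<And>x. x \<in> U x" "\<And>x. emeasure \<nu> (U x) < \<infinity>"
    using lf unfolding locally_finite_measure_def by metis
  obtain C where C: "C \<subseteq> K" "finite C" "K \<subseteq> (\<Union>x\<in>C. U x)"
    using compactE_image[OF \<open>compact K\<close>, of K U] U by blast
  have meas: "U ` C \<subseteq> sets \<nu>"
    using U(1) sets by auto
  have "emeasure \<nu> K \<le> emeasure \<nu> (\<Union>x\<in>C. U x)"
    using C(2,3) meas by (intro emeasure_mono sets.finite_UN) auto
  also have "\<dots> \<le> (\<Sum>x\<in>C. emeasure \<nu> (U x))"
    using C(2) meas by (intro emeasure_subadditive_finite) auto
  also have "\<dots> < \<infinity>"
    using U(3) C(2) by simp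
  finally show ?thesis .
qed

text \<open>The closure of a bounded set is compact by the Heine-Borel property. A non-measurable
  \<open>S\<close> is covered too, since \<open>emeasure\<close> is zero there by
  convention.\<close>

lemma locally_finite_measure_bounded:
  fixes \<nu> :: "'a::heine_borel measure"
  assumes "locally_finite_measure \<nu>" and "sets \<nu> = sets borel" and "bounded S"
  shows "emeasure \<nu> S < \<infinity>"
proof -
  have "emeasure \<nu> S \<le> emeasure \<nu> (closure S)"
    using assms by (intro emeasure_mono closure_subset) simp_all
  also have "\<dots> < \<infinity>"
    using assms by (intro locally_finite_measure_compact) simp_all
  finally show ?thesis .
qed

lemma locally_finite_measureI_bounded:
  fixes \<nu> :: "'a::metric_space measure"
  assumes "\<And>S. open S \<Longrightarrow> bounded S \<Longrightarrow> emeasure \<nu> S < \<infinity>"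
  shows "locally_finite_measure \<nu>"
  unfolding locally_finite_measure_def
proof
  fix x
  show "\<exists>U. open U \<and> x \<in> U \<and> emeasure \<nu> U < \<infinity>"
    using assms[OF open_ball bounded_ball] by (intro exI[of _ "ball x 1"]) simp
qed

text \<open>Balls of integer radius about the origin exhaust the space and have finite measure. This
  gives access to product measures and to Fubini's theorem.\<close>

lemma locally_finite_imp_sigma_finite_measure:
  fixes \<nu> :: "'a::euclidean_space measure"
  assumes lf: "locally_finite_measure \<nu>" and sets: "sets \<nu> = sets borel"
  shows "sigma_finite_measure \<nu>"
proof
  have "(\<Union>n::nat. ball (0::'a) (real n)) = UNIV"
    using reals_Archimedean2 by (auto simp: dist_norm)
  moreover have "emeasure \<nu> (ball 0 (real n)) \<noteq> \<infinity>" for n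
    using locally_finite_measure_bounded[OF lf sets bounded_ball] by (metis less_irrefl)
  moreover have "space \<nu> = UNIV"
    using sets_eq_imp_space_eq[OF sets] by simp
  ultimately show "\<exists>A. countable A \<and> A \<subseteq> sets \<nu> \<and> \<Union> A = space \<nu> \<and> (\<forall>a\<in>A. emeasure \<nu> a \<noteq> \<infinity>)"
    by (intro exI[of _ "range (\<lambda>n. ball 0 (real n))"]) (auto simp: sets)
qed

section \<open>Sums, products and point masses\<close>

text \<open>Intended for measures on the same sigma-algebra; the set function is then countably
  additive, so \<open>measure_of\<close> keeps its values.\<close>

definition add_measure :: "'a measure \<Rightarrow> 'a measure \<Rightarrow> 'a measure" where
  "add_measure M N = measure_of (space M) (sets M) (\<lambda>S. emeasure M S + emeasure N S)"

lemma sets_add_measure [simp, measurable_cong]: "sets (add_measure M N) = sets M"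
  by (simp add: add_measure_def)

lemma emeasure_add_measure:
  assumes "sets N = sets M" and "S \<in> sets M"
  shows "emeasure (add_measure M N) S = emeasure M S + emeasure N S"
  unfolding add_measure_def
proof (rule emeasure_measure_of_sigma)
  show "sigma_algebra (space M) (sets M)"
    by (rule sets.sigma_algebra_axioms)
  show "positive (sets M) (\<lambda>S. emeasure M S + emeasure N S)"
    by (simp add: positive_def)
  show "countably_additive (sets M) (\<lambda>S. emeasure M S + emeasure N S)"
  proof (rule countably_additiveI)
    fix F :: "nat \<Rightarrow> 'a set"
    assume F: "range F \<subseteq> sets M" "disjoint_family F"
    have "(\<Sum>i. emeasure M (F i) + emeasure N (F i)) = (\<Sum>i. emeasure M (F i)) + (\<Sum>i. emeasure N (F i))"
      by (intro suminf_add[symmetric] summableI)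
    also have "\<dots> = emeasure M (\<Union> (range F)) + emeasure N (\<Union> (range F))"
      using F assms(1) by (simp add: suminf_emeasure)
    finally show "(\<Sum>i. emeasure M (F i) + emeasure N (F i)) =
      emeasure M (\<Union> (range F)) + emeasure N (\<Union> (range F))" .
  qed
qed (fact assms(2))

lemma locally_finite_add_measure:
  fixes M :: "'a::euclidean_space measure"
  assumes "locally_finite_measure M" "sets M = sets borel"
    and "locally_finite_measure N" "sets N = sets borel"
  shows "locally_finite_measure (add_measure M N)"
proof (rule locally_finite_measureI_bounded)
  fix S :: "'a set" assume "open S" "bounded S"
  then show "emeasure (add_measure M N) S < \<infinity>"
    using assms by (simp add: emeasure_add_measure locally_finite_measure_bounded[simplified])
qed

lemma locally_finite_pair_measure:
  fixes M :: "'a::euclidean_space measure" and N :: "'b::euclidean_space measure"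
  assumes M: "locally_finite_measure M" "sets M = sets borel"
    and N: "locally_finite_measure N" "sets N = sets borel"
  shows "locally_finite_measure (M \<Otimes>\<^sub>M N)"
  unfolding locally_finite_measure_def
proof
  fix z :: "'a \<times> 'b"
  interpret N: sigma_finite_measure N
    using N by (rule locally_finite_imp_sigma_finite_measure)
  obtain U V where U: "open U" "fst z \<in> U" "emeasure M U < \<infinity>"
      and V: "open V" "snd z \<in> V" "emeasure N V < \<infinity>"
    using M(1) N(1) unfolding locally_finite_measure_def by metis
  have "emeasure (M \<Otimes>\<^sub>M N) (U \<times> V) = emeasure M U * emeasure N V"
    using U V M N by (intro N.emeasure_pair_measure_Times) simp_all
  also have "\<dots> < \<infinity>"
    using U V by (simp add: ennreal_mult_less_top)
  finally show "\<exists>W. open W \<and> z \<in> W \<and> emeasure (M \<Otimes>\<^sub>M N) W < \<infinity>"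
    using U V by (intro exI[of _ "U \<times> V"]) (auto simp: open_Times mem_Times_iff)
qed

lemma locally_finite_return: "locally_finite_measure (return borel (a::'a::metric_space))"
  by (rule locally_finite_measureI_bounded)
     (simp add: indicator_def)

section \<open>Passing from Lebesgue sets to Borel sets\<close>

text \<open>For each fixed \<open>y\<close> the exceptional \<open>x\<close> form a translate of
  \<open>N\<close>, which is null by translation invariance. Fubini's theorem exchanges the two
  almost-everywhere quantifiers.\<close>

lemma AE_reflected_translate_null:
  fixes \<nu> :: "'a::euclidean_space measure"
  assumes lf: "locally_finite_measure \<nu>" and sets[measurable_cong]: "sets \<nu> = sets borel"
    and N: "N \<in> null_sets lborel"
  shows "AE x in lborel. AE y in \<nu>. x - y \<notin> N"
proof -
  interpret \<nu>: sigma_finite_measure \<nu>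
    using lf sets by (rule locally_finite_imp_sigma_finite_measure)
  interpret P: pair_sigma_finite \<nu> lborel ..
  have [measurable]: "N \<in> sets borel"
    using N by auto
  have "AE x in lborel. x - y \<notin> N" for y
  proof -
    have "AE x in lborel. x \<notin> N"
      using N by (rule AE_not_in)
    then have "AE x in distr lborel borel ((+) (- y)). x \<notin> N"
      unfolding lborel_distr_plus .
    then show ?thesis
      by (subst (asm) AE_distr_iff) (simp_all add: algebra_simps)
  qed
  then have "AE y in \<nu>. AE x in lborel. x - y \<notin> N"
    by simp
  moreover have "{z \<in> space (\<nu> \<Otimes>\<^sub>M lborel). snd z - fst z \<notin> N} \<in> sets (\<nu> \<Otimes>\<^sub>M lborel)"
    by measurable
  ultimately show ?thesis
    using P.AE_commute[of "\<lambda>y x. x - y \<notin> N"] by simp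
qed

text \<open>For almost every \<open>x\<close>, the \<open>y\<close> at which the reflected
  translates of \<Omega> and \<Omega>' differ are \<nu>-negligible, so the Borel set may replace the
  original one under the integral.\<close>

lemma AE_convolve_indicator:
  fixes \<nu> :: "'a::euclidean_space measure"
  assumes lf: "locally_finite_measure \<nu>" and sets[measurable_cong]: "sets \<nu> = sets borel"
    and N: "N \<in> null_sets lborel" and sub: "sym_diff \<Omega> \<Omega>' \<subseteq> N"
    and [measurable]: "\<Omega>' \<in> sets borel"
  shows "AE x in lborel. convolve (indicator \<Omega>) \<nu> x = emeasure \<nu> {y. x - y \<in> \<Omega>'}"
  using AE_reflected_translate_null[OF lf sets N]
proof eventually_elim
  case (elim x)
  have "space \<nu> = UNIV"
    using sets_eq_imp_space_eq[OF sets] by simp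
  then have "{y. x - y \<in> \<Omega>'} \<in> sets \<nu>"
    using measurable_sets[of "\<lambda>y. x - y" \<nu> borel \<Omega>'] by (simp add: vimage_def)
  moreover have "convolve (indicator \<Omega>) \<nu> x = (\<integral>\<^sup>+ y. indicator {y. x - y \<in> \<Omega>'} y \<partial>\<nu>)"
    \<comment> \<open>The nonnegative integral of any function, measurable or not, is the same over
      \<nu> and its completion and is unaffected by changes on a \<nu>-null set.\<close>
    unfolding convolve_def nn_integral_completion
    using elim sub by (intro nn_integral_cong_AE) (auto simp: indicator_def elim!: eventually_mono)
  ultimately show ?case
    by simp
qed

text \<open>For Borel \<open>\<Omega>\<close>, the convolution of its indicator with \<open>\<nu>\<close> at \<open>x\<close> is the \<open>\<nu>\<close>-measure of \<open>x - \<Omega>\<close>.\<close>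

definition complement_tiling :: "'a::euclidean_space set \<Rightarrow> 'a measure \<Rightarrow> bool" where
  "complement_tiling \<Omega> \<nu> \<longleftrightarrow> sets \<nu> = sets borel \<and> locally_finite_measure \<nu> \<and>
     (AE x in lborel. emeasure \<nu> {y. x - y \<in> \<Omega>} = indicator (- \<Omega>) x)"

text \<open>The same \<nu> serves on both sides: off a null set of \<open>x\<close> the convolutions
  agree, and so do the indicators of the two complements.\<close>

lemma weakly_tiles_complement_iff:
  fixes \<Omega> :: "'a::euclidean_space set"
  assumes N: "N \<in> null_sets lborel" and sub: "sym_diff \<Omega> \<Omega>' \<subseteq> N"
    and meas: "\<Omega>' \<in> sets borel"
  shows "weakly_tiles_complement \<Omega> \<longleftrightarrow> (\<exists>\<nu>. complement_tiling \<Omega>' \<nu>)"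
proof -
  have "(AE x in lebesgue. convolve (indicator \<Omega>) \<nu> x = indicator (UNIV - \<Omega>) x) \<longleftrightarrow>
        (AE x in lborel. emeasure \<nu> {y. x - y \<in> \<Omega>'} = indicator (- \<Omega>') x)"
    if "sets \<nu> = sets borel" "locally_finite_measure \<nu>" for \<nu>
    unfolding AE_completion_iff
  proof (rule eventually_subst)
    show "AE x in lborel. (convolve (indicator \<Omega>) \<nu> x = indicator (UNIV - \<Omega>) x) =
        (emeasure \<nu> {y. x - y \<in> \<Omega>'} = indicator (- \<Omega>') x)"
      using AE_convolve_indicator[OF that(2,1) N sub meas] AE_not_in[OF N]
    proof eventually_elim
      case (elim x)
      then have "x \<in> \<Omega> \<longleftrightarrow> x \<in> \<Omega>'"
        using sub by blast
      then show ?case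
        using elim by (simp add: indicator_def)
    qed
  qed
  then show ?thesis
    unfolding weakly_tiles_complement_def weakly_tiles_def complement_tiling_def
    by (intro ex_cong1) blast
qed

lemma bounded_lebesgue_sets_almost_borel:
  fixes S :: "'a::euclidean_space set"
  assumes "S \<in> sets lebesgue" and "bounded S"
  obtains S' N where "S' \<in> sets borel" "bounded S'" "N \<in> null_sets lborel" "sym_diff S S' \<subseteq> N"
proof -
  obtain S' N N' where "S = S' \<union> N" "N \<subseteq> N'" "N' \<in> null_sets lborel" "S' \<in> sets lborel"
    using assms(1) by (rule sets_completionE)
  \<comment> \<open>The Borel part \<open>S'\<close> lies inside \<open>S\<close> and so inherits
    boundedness; what is lost lies in \<open>N'\<close>.\<close>
  then show thesis
    using assms(2) by (intro that[of S' N']) auto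
qed

section \<open>From tilings of the factors to a tiling of the product\<close>

text \<open>Writing 1_S for the indicator of a set S, the constructed measure gives 1_A 1_{-B} +
  1_{-A} (1_B + 1_{-B}) almost everywhere. The bracket is 1, and the sum is the indicator of the
  complement of \<open>A \<times> B\<close>.\<close>

lemma complement_tiling_prod:
  fixes A :: "'a::euclidean_space set" and B :: "'b::euclidean_space set"
  assumes [measurable]: "A \<in> sets borel" "B \<in> sets borel"
    and M: "complement_tiling A M" and N: "complement_tiling B N"
  shows "\<exists>\<nu>. complement_tiling (A \<times> B) \<nu>"
proof -
  have sM [measurable_cong, simp]: "sets M = sets borel" and lM: "locally_finite_measure M"
    and sN [measurable_cong, simp]: "sets N = sets borel" and lN: "locally_finite_measure N"
    using M N by (auto simp: complement_tiling_def)
  define N' where "N' = add_measure (return borel 0) N"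
  \<comment> \<open>This is the product of the two sums with its point mass at the origin removed,
    grouped into two summands so that nothing is subtracted from a measure.\<close>
  define \<nu> where "\<nu> = add_measure (return borel (0::'a) \<Otimes>\<^sub>M N) (M \<Otimes>\<^sub>M N')"
  have sN' [measurable_cong, simp]: "sets N' = sets borel"
    by (simp add: N'_def)
  have lN': "locally_finite_measure N'"
    unfolding N'_def by (intro locally_finite_add_measure locally_finite_return lN) simp_all
  interpret N: sigma_finite_measure N
    using lN sN by (rule locally_finite_imp_sigma_finite_measure)
  interpret N': sigma_finite_measure N'
    using lN' sN' by (rule locally_finite_imp_sigma_finite_measure)
  have s1: "sets (return borel (0::'a) \<Otimes>\<^sub>M N) = sets borel" and s2: "sets (M \<Otimes>\<^sub>M N') = sets borel"
    using sets_pair_measure_cong[of "return borel (0::'a)" borel N borel]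
      sets_pair_measure_cong[of M borel N' borel]
    by (simp_all add: borel_prod[symmetric])
  have emeasure_\<nu>: "emeasure \<nu> {z. (x, y) - z \<in> A \<times> B} =
      indicator A x * emeasure N {t. y - t \<in> B} +
      emeasure M {s. x - s \<in> A} * (indicator B y + emeasure N {t. y - t \<in> B})" for x y
  proof -
    have eq: "{z. (x, y) - z \<in> A \<times> B} = {s. x - s \<in> A} \<times> {t. y - t \<in> B}"
      by auto
    have slices: "{s. x - s \<in> A} \<in> sets borel" "{t. y - t \<in> B} \<in> sets borel"
      by measurable
    then have "{s. x - s \<in> A} \<times> {t. y - t \<in> B} \<in> sets borel"
      by (rule borel_Times)
    moreover have "emeasure N' {t. y - t \<in> B} = indicator B y + emeasure N {t. y - t \<in> B}"
      using slices by (simp add: N'_def emeasure_add_measure indicator_def)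
    ultimately show ?thesis
      using slices
      unfolding \<nu>_def eq
      by (subst emeasure_add_measure)
         (simp_all add: s1 s2 N.emeasure_pair_measure_Times N'.emeasure_pair_measure_Times indicator_def)
  qed
  have "complement_tiling (A \<times> B) \<nu>"
    unfolding complement_tiling_def
  proof (intro conjI)
    show "sets \<nu> = sets borel"
      unfolding \<nu>_def using s1 by (simp only: sets_add_measure)
    show "locally_finite_measure \<nu>"
      unfolding \<nu>_def
      by (intro locally_finite_add_measure locally_finite_pair_measure locally_finite_return lM lN lN' s1 s2)
         simp_all
    obtain U where U: "U \<in> null_sets lborel"
      "{x. emeasure M {s. x - s \<in> A} \<noteq> indicator (- A) x} \<subseteq> U"
      using M by (auto simp: complement_tiling_def eventually_ae_filter)
    obtain V where V: "V \<in> null_sets lborel"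
      "{y. emeasure N {t. y - t \<in> B} \<noteq> indicator (- B) y} \<subseteq> V"
      using N by (auto simp: complement_tiling_def eventually_ae_filter)
    \<comment> \<open>Exceptional points of either factor become null cylinders in the
      product.\<close>
    have "U \<times> UNIV \<in> null_sets (lborel :: ('a \<times> 'b) measure)"
      "UNIV \<times> V \<in> null_sets (lborel :: ('a \<times> 'b) measure)"
      using U V unfolding lborel_prod[symmetric] by auto
    then have "AE z in lborel :: ('a \<times> 'b) measure. z \<notin> U \<times> UNIV"
      "AE z in lborel :: ('a \<times> 'b) measure. z \<notin> UNIV \<times> V"
      by (auto dest: AE_not_in)
    then show "AE z in lborel. emeasure \<nu> {w. z - w \<in> A \<times> B} = indicator (- (A \<times> B)) z"
    proof eventually_elim
      case (elim z)
      obtain x y where z: "z = (x, y)"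
        by (cases z)
      have "emeasure M {s. x - s \<in> A} = indicator (- A) x"
        "emeasure N {t. y - t \<in> B} = indicator (- B) y"
        using elim U V by (auto simp: z)
      then show ?case
        unfolding z emeasure_\<nu> by (simp add: indicator_def)
    qed
  qed
  then show ?thesis ..
qed

section \<open>From a tiling of the product back to the factors\<close>

text \<open>If \<Omega> were null, almost all its reflected translates would have \<nu>-measure 0,
  while the tiling equation demands 1 almost everywhere. Lebesgue measure is not the zero measure,
  so this is impossible.\<close>

lemma complement_tiling_not_null:
  fixes \<Omega> :: "'a::euclidean_space set"
  assumes tiling: "complement_tiling \<Omega> \<nu>"
  shows "\<Omega> \<notin> null_sets lborel"
proof
  assume null: "\<Omega> \<in> null_sets lborel"
  have lf: "locally_finite_measure \<nu>" and sets: "sets \<nu> = sets borel"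
    and tiles: "AE x in lborel. emeasure \<nu> {y. x - y \<in> \<Omega>} = indicator (- \<Omega>) x"
    using tiling by (auto simp: complement_tiling_def)
  from AE_reflected_translate_null[OF lf sets null] tiles AE_not_in[OF null]
  have "AE x in (lborel :: 'a measure). False"
  proof eventually_elim
    case (elim x)
    have "emeasure \<nu> {y. x - y \<in> \<Omega>} = 0"
      using emeasure_eq_0_AE[of "\<lambda>y. x - y \<in> \<Omega>" \<nu>] elim(1) sets_eq_imp_space_eq[OF sets] by simp
    then show ?case
      using elim by simp
  qed
  then show False
    by (simp add: eventually_False ae_filter_eq_bot_iff)
qed

text \<open>Once \<open>x\<close> is fixed in \<open>A\<close>, the point \<open>(x, y)\<close> lies
  outside \<open>A \<times> B\<close> exactly when \<open>y\<close> lies outside \<open>B\<close>.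
  The tiling equation on this slice is therefore one for \<open>B\<close> alone.\<close>

lemma complement_tiling_snd:
  fixes A :: "'a::euclidean_space set" and B :: "'b::euclidean_space set"
  assumes [measurable]: "A \<in> sets borel" "B \<in> sets borel"
    and tiling: "complement_tiling (A \<times> B) \<nu>" and "bounded A"
  shows "\<exists>\<nu>. complement_tiling B \<nu>"
proof -
  have s [measurable_cong, simp]: "sets \<nu> = sets borel" and lf: "locally_finite_measure \<nu>"
    and AE: "AE z in lborel. emeasure \<nu> {w. z - w \<in> A \<times> B} = indicator (- (A \<times> B)) z"
    using tiling by (auto simp: complement_tiling_def)
  have space: "space \<nu> = UNIV"
    using sets_eq_imp_space_eq[OF s] by simp
  have "A \<notin> null_sets lborel"
  proof
    assume "A \<in> null_sets lborel"
    then have "A \<times> B \<in> null_sets lborel"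
      unfolding lborel_prod[symmetric] by auto
    then show False
      using complement_tiling_not_null[OF tiling] by simp
  qed
  have "AE x in lborel. AE y in lborel.
      emeasure \<nu> {w. (x, y) - w \<in> A \<times> B} = indicator (- (A \<times> B)) (x, y)"
    using AE unfolding lborel_prod[symmetric] by (rule lborel_pair.AE_pair)
  moreover have "\<not> (AE x in lborel. x \<notin> A)"
    using \<open>A \<notin> null_sets lborel\<close> by (simp add: AE_iff_null_sets)
  \<comment> \<open>Almost every slice satisfies the equation and \<open>A\<close> is not null, so
    some good slice has its base point in \<open>A\<close>.\<close>
  ultimately have "\<exists>x\<in>A. AE y in lborel.
      emeasure \<nu> {w. (x, y) - w \<in> A \<times> B} = indicator (- (A \<times> B)) (x, y)"
    by (meson eventually_mono)
  then obtain x where x: "x \<in> A" and AE': "AE y in lborel.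
      emeasure \<nu> {w. (x, y) - w \<in> A \<times> B} = indicator (- (A \<times> B)) (x, y)" ..
  define S where "S = {w :: 'a \<times> 'b. x - fst w \<in> A}"
  have [measurable]: "S \<in> sets borel"
    using measurable_sets[of "\<lambda>w :: 'a \<times> 'b. x - fst w" borel borel A]
    by (simp add: S_def vimage_def borel_measurable_continuous_onI continuous_intros)
  have snd [measurable]: "snd \<in> borel_measurable (borel :: ('a \<times> 'b) measure)"
    by (intro borel_measurable_continuous_onI continuous_intros)
  \<comment> \<open>Since \<open>S\<close> is the cylinder over \<open>x - A\<close>, the density
    restricts \<nu> to it before projecting.\<close>
  define \<mu> where "\<mu> = distr (density \<nu> (indicator S)) borel snd"
  have emeasure_\<mu>: "emeasure \<mu> T = emeasure \<nu> {w. x - fst w \<in> A \<and> snd w \<in> T}"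
    if [measurable]: "T \<in> sets borel" for T
  proof -
    have [measurable]: "snd -` T \<in> sets (borel :: ('a \<times> 'b) measure)"
      using measurable_sets[of "snd :: 'a \<times> 'b \<Rightarrow> 'b" borel borel T] snd by simp
    have "emeasure \<mu> T = (\<integral>\<^sup>+ w. indicator S w * indicator (snd -` T) w \<partial>\<nu>)"
      unfolding \<mu>_def by (subst emeasure_distr) (simp_all add: space emeasure_density)
    also have "\<dots> = (\<integral>\<^sup>+ w. indicator (S \<inter> snd -` T) w \<partial>\<nu>)"
      by (simp add: indicator_inter_arith)
    also have "\<dots> = emeasure \<nu> (S \<inter> snd -` T)"
      by (intro nn_integral_indicator) simp
    finally show ?thesis
      by (simp add: S_def Int_def)
  qed
  have "complement_tiling B \<mu>"
    unfolding complement_tiling_def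
  proof (intro conjI)
    show "sets \<mu> = sets borel"
      by (simp add: \<mu>_def)
    show "locally_finite_measure \<mu>"
    proof (rule locally_finite_measureI_bounded)
      fix T :: "'b set" assume T: "open T" "bounded T"
      \<comment> \<open>Boundedness of \<open>A\<close> enters here: the part of the cylinder over a
        bounded \<open>T\<close> is itself bounded, hence of finite \<nu>-measure.\<close>
      have "{w. x - fst w \<in> A \<and> snd w \<in> T} = (\<lambda>a. x - a) ` A \<times> T"
        by (force simp: image_iff)
      moreover have "bounded ((\<lambda>a. x - a) ` A)"
        using \<open>bounded A\<close> bounded_minus_comp[of "\<lambda>_. x" A "\<lambda>a. a"] by (simp add: image_constant_conv)
      ultimately have "bounded {w. x - fst w \<in> A \<and> snd w \<in> T}"
        using T by (simp add: bounded_Times)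
      then show "emeasure \<mu> T < \<infinity>"
        using T locally_finite_measure_bounded[OF lf s] by (simp only: emeasure_\<mu> borel_open)
    qed
    show "AE y in lborel. emeasure \<mu> {t. y - t \<in> B} = indicator (- B) y"
      using AE'
    proof eventually_elim
      case (elim y)
      have "emeasure \<mu> {t. y - t \<in> B} = emeasure \<nu> {w. (x, y) - w \<in> A \<times> B}"
        by (subst emeasure_\<mu>) (simp_all add: mem_Times_iff)
      then show ?case
        using elim x by (simp add: indicator_def)
    qed
  qed
  then show ?thesis ..
qed

text \<open>Exchanging coordinates preserves Lebesgue measure and local finiteness, so the
  pushforward of \<nu> tiles the swapped complement. This makes the projection to the second factor
  usable for the first.\<close>

lemma complement_tiling_swap:
  fixes A :: "'a::euclidean_space set" and B :: "'b::euclidean_space set"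
  assumes [measurable]: "A \<in> sets borel" "B \<in> sets borel"
    and tiling: "complement_tiling (A \<times> B) \<nu>"
  shows "\<exists>\<nu>. complement_tiling (B \<times> A) \<nu>"
proof -
  have s [measurable_cong, simp]: "sets \<nu> = sets borel" and lf: "locally_finite_measure \<nu>"
    and AE: "AE z in lborel. emeasure \<nu> {w. z - w \<in> A \<times> B} = indicator (- (A \<times> B)) z"
    using tiling by (auto simp: complement_tiling_def)
  have space: "space \<nu> = UNIV"
    using sets_eq_imp_space_eq[OF s] by simp
  \<comment> \<open>The types are left general because the exchange is used in both directions: to
    push \<nu> forward and to transport the almost-everywhere statement back.\<close>
  have swap [measurable]: "prod.swap \<in> measurable borel (borel :: ('c::euclidean_space \<times> 'd::euclidean_space) measure)"
    by (intro borel_measurable_continuous_onI continuous_on_swap)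
  have lborel_swap: "distr lborel borel prod.swap = (lborel :: ('a \<times> 'b) measure)"
  proof -
    have "distr lborel borel prod.swap =
        distr (lborel \<Otimes>\<^sub>M lborel) (lborel \<Otimes>\<^sub>M lborel :: ('a \<times> 'b) measure) (\<lambda>(x, y). (y, x))"
      by (rule distr_cong) (simp_all only: lborel_prod sets_lborel prod.swap_def case_prod_unfold)
    then show ?thesis
      using lborel_pair.distr_pair_swap[where 'a='a and 'b='b] by (simp add: lborel_prod)
  qed
  define \<mu> where "\<mu> = distr \<nu> borel prod.swap"
  have emeasure_\<mu>: "emeasure \<mu> T = emeasure \<nu> (prod.swap -` T)" if "T \<in> sets borel" for T
    unfolding \<mu>_def using that by (subst emeasure_distr) (simp_all add: space measurable_cong_sets[OF s refl] swap)
  have "complement_tiling (B \<times> A) \<mu>"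
    unfolding complement_tiling_def
  proof (intro conjI)
    show "sets \<mu> = sets borel"
      by (simp add: \<mu>_def)
    show "locally_finite_measure \<mu>"
    proof (rule locally_finite_measureI_bounded)
      fix T :: "('b \<times> 'a) set" assume T: "open T" "bounded T"
      have "prod.swap -` T = prod.swap ` T"
        by force
      moreover have "bounded (prod.swap ` T)"
        using \<open>bounded T\<close> by (auto simp: bounded_iff norm_Pair norm_prod_def add.commute)
      ultimately have "bounded (prod.swap -` T)"
        by simp
      then show "emeasure \<mu> T < \<infinity>"
        using T locally_finite_measure_bounded[OF lf s] by (simp only: emeasure_\<mu> borel_open)
    qed
    have "AE z in distr lborel borel prod.swap. emeasure \<nu> {w. z - w \<in> A \<times> B} = indicator (- (A \<times> B)) z"
      using AE unfolding lborel_swap .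
    then have "AE z in lborel :: ('b \<times> 'a) measure.
        emeasure \<nu> {w. prod.swap z - w \<in> A \<times> B} = indicator (- (A \<times> B)) (prod.swap z)"
      by (rule AE_distrD[rotated]) (simp add: swap)
    then show "AE z in lborel. emeasure \<mu> {w. z - w \<in> B \<times> A} = indicator (- (B \<times> A)) z"
    proof eventually_elim
      case (elim z)
      have "B \<times> A \<in> sets borel"
        by (simp add: borel_Times)
      then have "{w. z - w \<in> B \<times> A} \<in> sets borel"
        using measurable_sets[of "\<lambda>w. z - w" borel borel "B \<times> A"] by (simp add: vimage_def)
      moreover have "prod.swap -` {w. z - w \<in> B \<times> A} = {w. prod.swap z - w \<in> A \<times> B}"
        by (auto simp: mem_Times_iff)
      ultimately show ?case
        using elim by (auto simp: emeasure_\<mu> indicator_def mem_Times_iff)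
    qed
  qed
  then show ?thesis ..
qed

theorem theorem1p7:
  fixes A :: "(real ^ 'n) set" and B :: "(real ^ 'm) set"
  assumes "bounded A" and "A \<in> sets lebesgue"
    and "bounded B" and "B \<in> sets lebesgue"
  shows "weakly_tiles_complement (A \<times> B) \<longleftrightarrow>
         weakly_tiles_complement A \<and> weakly_tiles_complement B"
proof -
  obtain A' U where A': "A' \<in> sets borel" "bounded A'" "U \<in> null_sets lborel" "sym_diff A A' \<subseteq> U"
    using bounded_lebesgue_sets_almost_borel[OF assms(2,1)] .
  obtain B' V where B': "B' \<in> sets borel" "bounded B'" "V \<in> null_sets lborel" "sym_diff B B' \<subseteq> V"
    using bounded_lebesgue_sets_almost_borel[OF assms(4,3)] .
  \<comment> \<open>A point in just one of the two products has its first coordinate in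
    \<open>U\<close> or its second in \<open>V\<close>.\<close>
  have "U \<times> UNIV \<union> UNIV \<times> V \<in> null_sets (lborel :: ((real ^ 'n) \<times> (real ^ 'm)) measure)"
    using A' B' unfolding lborel_prod[symmetric]
    by (intro null_sets.Un lborel.times_in_null_sets1 lborel.times_in_null_sets2) simp_all
  moreover have "sym_diff (A \<times> B) (A' \<times> B') \<subseteq> U \<times> UNIV \<union> UNIV \<times> V"
    using A'(4) B'(4) by auto
  moreover have "A' \<times> B' \<in> sets borel"
    using A' B' by (simp add: borel_Times)
  ultimately have "weakly_tiles_complement (A \<times> B) \<longleftrightarrow> (\<exists>\<nu>. complement_tiling (A' \<times> B') \<nu>)"
    by (rule weakly_tiles_complement_iff)
  \<comment> \<open>A tiling for \<open>B'\<close> comes by direct projection, using that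
    \<open>A'\<close> is bounded; one for \<open>A'\<close> comes by swapping first, using that
    \<open>B'\<close> is bounded.\<close>
  also have "\<dots> \<longleftrightarrow> (\<exists>\<nu>. complement_tiling A' \<nu>) \<and> (\<exists>\<nu>. complement_tiling B' \<nu>)"
    using complement_tiling_prod[OF A'(1) B'(1)] complement_tiling_snd[OF A'(1) B'(1) _ A'(2)]
      complement_tiling_swap[OF A'(1) B'(1)] complement_tiling_snd[OF B'(1) A'(1) _ B'(2)] by blast
  also have "\<dots> \<longleftrightarrow> weakly_tiles_complement A \<and> weakly_tiles_complement B"
    using weakly_tiles_complement_iff[OF A'(3,4,1)] weakly_tiles_complement_iff[OF B'(3,4,1)] by simp
  finally show ?thesis .
qed

end
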